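(* Let $r\ge 3$ be an odd integer and put $N=r^2-4=(r-2)(r+2)$. Define numbers $a_1,\dots,a_{4N}$ as follows: \[ a_{N}=(-1)^{(r+1)/2}\,4\beta^{N},\qquad a_{3N}=(-1)^{(r-1)/2}\,4\beta^{3N}; \] for every index $i\notin\{N,3N\}$ of one of the following forms, \[ a_{(r-2)(4j-3)}=-(r-2)\beta^{(r-2)(4j-3)},\quad a_{(r-2)(4j-1)}=(r-2)\beta^{(r-2)(4j-1)}\quad (j=1,\dots,r+2), \] \[ a_{(r+2)(4j-3)}=(r+2)\beta^{(r+2)(4j-3)},\quad a_{(r+2)(4j-1)}=-(r+2)\beta^{(r+2)(4j-1)}\quad (j=1,\dots,r-2); \] and $a_i=0$ for all other $i\in\{1,\dots,4N\}$. Then \[ \arctan\frac{1}{F_r}=P\bigl(1,\alpha^{4N},4N,(a_1,a_2,\dots,a_{4N})\bigr)=\sum_{k=0}^\infty\frac{1}{\alpha^{4Nk}}\sum_{i=1}^{4N}\frac{a_i}{4Nk+i}. \]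
   Context: $\alpha=(1+\sqrt5)/2$ is the golden ratio and $\beta=-1/\alpha=(1-\sqrt5)/2$. The Fibonacci numbers are $F_n=(\alpha^n-\beta^n)/\sqrt5$. For integers $s,n\ge1$, a number $b$ with $|b|>1$ and a vector $A=(a_1,\dots,a_n)$, the notation $P(s,b,n,A)$ denotes $\sum_{k=0}^\infty b^{-k}\sum_{j=1}^n a_j/(kn+j)^s$. *)

theory Defs
  imports Complex_Main "HOL-Number_Theory.Fib"
begin

definition golden :: real where
  "golden = (1 + sqrt 5) / 2"

definition golden_conj :: real where
  "golden_conj = - 1 / golden"

lemma golden_conj_eq: "golden_conj = (1 - sqrt 5) / 2"
proof -
  have "(1 + sqrt 5) * (1 - sqrt 5) = (- 4 :: real)"
    by (simp add: algebra_simps)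
  moreover have "1 + sqrt 5 \<noteq> (0 :: real)"
    using real_sqrt_ge_zero[of 5] by linarith
  ultimately show ?thesis
    by (simp add: golden_conj_def golden_def field_simps)
qed

lemma fib_Binet: "real (fib n) = (golden ^ n - golden_conj ^ n) / sqrt 5"
  by (simp add: fib_closed_form golden_def golden_conj_eq)

text \<open>
  The sum \<open>P(s, b, n, A)\<close> with \<open>A = (a 1, \<dots>, a n)\<close>: the vector is a function on
  indices, of which only the values at \<open>1, \<dots>, n\<close> are used.  Intended for \<open>s, n \<ge> 1\<close> and
  \<open>\<bar>b\<bar> > 1\<close>, where the series converges.
\<close>

definition P :: "nat \<Rightarrow> real \<Rightarrow> nat \<Rightarrow> (nat \<Rightarrow> real) \<Rightarrow> real" where
  "P s b n a = (\<Sum>k. 1 / b ^ k * (\<Sum>j = 1..n. a j / real (k * n + j) ^ s))"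

end

theory Submission
  imports Defs
begin

text \<open>
  Since \<open>r\<close> is odd, the addition theorem gives
  \<open>arctan (1 / F r) = arctan (\<beta> ^ (r + 2)) - arctan (\<beta> ^ (r - 2))\<close>.  Each Gregory series
  \<open>arctan (\<beta> ^ d) = (\<Sum>m odd. \<plusminus> d \<beta> ^ (d m) / (d m))\<close> is a sum over exponents \<open>i = d m\<close>
  whose coefficients have period \<open>4 N\<close> up to the factor \<open>\<beta> ^ (4 N) = \<alpha> ^ (- 4 N)\<close>.  The two
  supports meet only in odd multiples of \<open>N\<close>, because \<open>r - 2\<close> and \<open>r + 2\<close> are coprime;
  there the coefficients \<open>r + 2\<close> and \<open>r - 2\<close> leave the difference \<open>4\<close>.
\<close>

section \<open>Gregory series and the nontrivial character modulo 4\<close>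

definition chi4 :: "nat \<Rightarrow> real" where
  "chi4 m = (if odd m then (- 1) ^ (m div 2) else 0)"

text \<open>Numerator over \<open>i\<close>, not over \<open>i div d\<close>: writing
  \<open>x ^ (d * m) / m\<close> as \<open>d * x ^ (d * m) / (d * m)\<close> gives the series for
  different \<open>d\<close> the common denominators \<open>i\<close>, whence the factor
  \<open>real d\<close>.\<close>

definition gregory_coeff :: "real \<Rightarrow> nat \<Rightarrow> nat \<Rightarrow> real" where
  "gregory_coeff x d i = (if d dvd i then chi4 (i div d) * real d * x ^ i else 0)"

lemma chi4_odd: "chi4 (2 * k + 1) = (- 1) ^ k"
  by (simp add: chi4_def)

lemma chi4_add_4_mult: "chi4 (4 * m + n) = chi4 n"
proof -
  have "(4 * m + n) div 2 = 2 * m + n div 2" by presburger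
  then show ?thesis by (simp add: chi4_def power_add)
qed

lemma gregory_coeff_mult:
  "d > 0 \<Longrightarrow> gregory_coeff x d (d * m) = chi4 m * real d * x ^ (d * m)"
  by (simp add: gregory_coeff_def)

text \<open>As \<open>d\<close> divides \<open>N\<close>, the shift changes \<open>i div d\<close>
  by a multiple of 4, a period of \<open>chi4\<close>; only the power of \<open>x\<close> changes.
  This is what folds the infinite series into blocks of length \<open>4 * N\<close>.\<close>

lemma gregory_coeff_shift:
  assumes "d dvd N"
  shows "gregory_coeff x d (4 * N * k + i) = x ^ (4 * N * k) * gregory_coeff x d i"
proof (cases "d = 0")
  case True
  then show ?thesis by (simp add: gregory_coeff_def)
next
  case False
  obtain M where N: "N = d * M" using assms by (auto elim: dvdE)
  have dvd: "d dvd 4 * N * k + i \<longleftrightarrow> d dvd i"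
    by (simp add: N mult.assoc dvd_add_right_iff)
  have "4 * N * k + i = i + d * (4 * (M * k))" by (simp add: N ac_simps)
  then have "(4 * N * k + i) div d = 4 * (M * k) + i div d"
    by (simp only: div_mult_self2[OF False])
  with dvd show ?thesis
    by (simp add: gregory_coeff_def chi4_add_4_mult power_add)
qed

text \<open>The Gregory series of \<open>arctan (x ^ d)\<close> is spread out over all exponents:
  \<open>g\<close> lists the odd multiples of \<open>d\<close>, and the zeros inserted elsewhere
  leave the sum unchanged.\<close>

lemma gregory_coeff_sums:
  fixes x :: real
  assumes "d > 0" and "\<bar>x\<bar> \<le> 1"
  shows "(\<lambda>i. gregory_coeff x d i / real i) sums arctan (x ^ d)"
proof -
  define g where "g k = d * (2 * k + 1)" for k
  have x: "\<bar>x ^ d\<bar> \<le> 1" using assms by (simp add: power_abs power_le_one)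
  have "(\<lambda>k. (- 1) ^ k * (1 / real (k * 2 + 1) * (x ^ d) ^ (k * 2 + 1))) sums arctan (x ^ d)"
    using summable_sums[OF summable_arctan_series[OF x]] arctan_series[OF x] by simp
  moreover have "gregory_coeff x d (g k) / real (g k)
      = (- 1) ^ k * (1 / real (k * 2 + 1) * (x ^ d) ^ (k * 2 + 1))" for k
    using assms(1)
    unfolding g_def gregory_coeff_mult[OF assms(1)] chi4_odd power_mult[of x d] of_nat_mult
      mult.commute[of k 2]
    by (simp del: power_Suc)
  ultimately have "(\<lambda>k. gregory_coeff x d (g k) / real (g k)) sums arctan (x ^ d)"
    by simp
  moreover have "strict_mono g"
    using assms(1) by (auto simp: g_def strict_mono_def)
  moreover have "gregory_coeff x d i / real i = 0" if "i \<notin> range g" for i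
  proof (cases "d dvd i \<and> odd (i div d)")
    case True
    then obtain k where "i div d = 2 * k + 1" by (auto elim: oddE)
    with True have "i = g k" by (metis dvd_mult_div_cancel g_def)
    with that show ?thesis by blast
  qed (auto simp: gregory_coeff_def chi4_def)
  ultimately show ?thesis
    using sums_mono_reindex[of g "\<lambda>i. gregory_coeff x d i / real i"] by simp
qed

section \<open>The golden ratio and the arctangent identity\<close>

lemma golden_conj_identities:
  shows golden_times_conj: "golden * golden_conj = - 1"
    and golden_sq_diff: "golden ^ 2 - golden_conj ^ 2 = sqrt 5"
    and abs_golden_conj_less_1: "\<bar>golden_conj\<bar> < 1"
proof -
  have "2 < sqrt 5" "sqrt 5 < 3" by (auto intro: real_less_rsqrt real_less_lsqrt)
  then show "\<bar>golden_conj\<bar> < 1" by (auto simp: golden_conj_eq)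
  show "golden * golden_conj = - 1" "golden ^ 2 - golden_conj ^ 2 = sqrt 5"
    by (auto simp: golden_def golden_conj_eq power2_eq_square field_simps)
qed

text \<open>With \<open>u = B ^ (s + 4)\<close> and \<open>v = - (B ^ s)\<close> the addition
  theorem produces the argument \<open>(u + v) / (1 - u * v)\<close>, which Binet's formula
  evaluates. Oddness of \<open>s\<close> enters through \<open>A ^ s * B ^ s = - 1\<close>.\<close>

lemma arctan_inverse_fib:
  assumes "odd s"
  shows "arctan (1 / real (fib (s + 2)))
    = arctan (golden_conj ^ (s + 4)) - arctan (golden_conj ^ s)"
proof -
  define A B p q where "A = golden" and "B = golden_conj" and "p = B ^ s" and "q = A ^ s"
  have AB: "A * B = - 1" and sq: "A\<^sup>2 - B\<^sup>2 = sqrt 5" and B1: "\<bar>B\<bar> < 1"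
    using golden_conj_identities by (auto simp: A_def B_def)
  have pq: "q * p = - 1"
    using assms AB by (simp add: p_def q_def flip: power_mult_distrib)
  have "s > 0" using assms by (rule odd_pos)
  then have small: "\<bar>B ^ (s + 4)\<bar> < 1" "\<bar>- p\<bar> < 1"
    using B1 by (auto simp: p_def power_abs power_less_one_iff simp del: power_Suc)
  have binet: "real (fib (s + 2)) * sqrt 5 = q * A\<^sup>2 - p * B\<^sup>2"
    unfolding fib_Binet A_def B_def p_def q_def power_add by simp
  have "real (fib (s + 2)) * (p * B ^ 4 - p) * sqrt 5
      = (q * A\<^sup>2 - p * B\<^sup>2) * (p * B ^ 4 - p)"
    by (simp only: flip: binet) (simp only: ac_simps)
  \<comment> \<open>By \<open>q * p = - 1\<close> and \<open>A * B = - 1\<close>, both sides expand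
    to \<open>A\<^sup>2 - B\<^sup>2 + p\<^sup>2 * (B\<^sup>2 - B ^ 6)\<close>.\<close>
  also have "\<dots> = (1 + p * B ^ 4 * p) * (A\<^sup>2 - B\<^sup>2)"
    using AB pq by algebra
  also have "\<dots> = (1 + p * B ^ 4 * p) * sqrt 5" by (simp only: sq)
  finally have key: "real (fib (s + 2)) * (p * B ^ 4 - p) = 1 + p * B ^ 4 * p" by simp
  have "p * B ^ 4 * p = (p * B\<^sup>2)\<^sup>2" by (simp add: power2_eq_square eval_nat_numeral)
  then have pos: "1 + p * B ^ 4 * p > 0" by (simp add: add_pos_nonneg)
  have "fib (s + 2) > 0" by (simp add: fib_neq_0_nat)
  then have "(p * B ^ 4 - p) / (1 + p * B ^ 4 * p) = 1 / real (fib (s + 2))"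
    using key pos by (simp add: field_simps del: fib.simps)
  moreover have "arctan (B ^ (s + 4)) + arctan (- p)
      = arctan ((p * B ^ 4 - p) / (1 + p * B ^ 4 * p))"
    using arctan_add[of "B ^ (s + 4)" "- p"] small
    by (simp add: power_add p_def del: power_Suc)
  ultimately show ?thesis by (simp add: B_def p_def arctan_minus del: power_Suc)
qed

section \<open>Supports of the coefficients within one period\<close>

lemma odd_common_multiple_cases:
  fixes u v i :: nat
  assumes "coprime u v" and "u dvd i" and "v dvd i" and "odd i" and "i \<le> 4 * (u * v)"
  shows "i \<in> {u * v, 3 * (u * v)}"
proof -
  have "u * v dvd i" using assms by (simp add: divides_mult)
  then obtain m where m: "i = u * v * m" by (auto elim: dvdE)
  with \<open>odd i\<close> have "odd m" "u * v > 0" by (auto intro: odd_pos)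
  with m assms(5) have "m \<le> 4" by (metis mult.commute mult_le_cancel2)
  with \<open>odd m\<close> have "m = 1 \<or> m = 3" by presburger
  with m show ?thesis by auto
qed

lemma odd_index_cases:
  fixes m n :: nat
  assumes "odd m" and "m \<le> 4 * n"
  obtains j where "j \<in> {1..n}" and "m = 4 * j - 3" | j where "j \<in> {1..n}" and "m = 4 * j - 1"
proof -
  have "m = 4 * (m div 4 + 1) - 3 \<or> m = 4 * (m div 4 + 1) - 1" "m div 4 + 1 \<in> {1..n}"
    using assms by (auto, presburger+)
  then show ?thesis using that by blast
qed

text \<open>The residues 1 and 3 modulo 4 carry opposite signs; \<open>j \<ge> 1\<close> keeps the
  truncated subtractions exact.\<close>

lemma gregory_coeff_residues:
  assumes "d > 0" and "j \<ge> 1"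
  shows "gregory_coeff x d (d * (4 * j - 3)) = real d * x ^ (d * (4 * j - 3))"
    and "gregory_coeff x d (d * (4 * j - 1)) = - (real d * x ^ (d * (4 * j - 1)))"
proof -
  obtain l where "j = Suc l" using assms(2) by (cases j) auto
  then have "4 * j - 3 = 2 * (2 * l) + 1" "4 * j - 1 = 2 * (2 * l + 1) + 1" by auto
  then have "chi4 (4 * j - 3) = 1" "chi4 (4 * j - 1) = - 1"
    unfolding chi4_odd by (simp_all only: chi4_odd) simp_all
  then show "gregory_coeff x d (d * (4 * j - 3)) = real d * x ^ (d * (4 * j - 3))"
    and "gregory_coeff x d (d * (4 * j - 1)) = - (real d * x ^ (d * (4 * j - 1)))"
    by (simp_all add: gregory_coeff_mult assms(1))
qed

text \<open>Used contrapositively: an index of neither listed form has coefficient zero, which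
  matches the clause \<open>a i = 0\<close> of the theorem.\<close>

lemma gregory_coeff_nonzeroE:
  assumes "gregory_coeff x d i \<noteq> 0" and "i \<le> 4 * (d * n)"
  obtains j where "j \<in> {1..n}" and "i = d * (4 * j - 3)"
  | j where "j \<in> {1..n}" and "i = d * (4 * j - 1)"
proof -
  from assms(1) have "d dvd i" "odd (i div d)" "d > 0"
    by (auto simp: gregory_coeff_def chi4_def split: if_splits)
  then obtain m where m: "i = d * m" "odd m" by (auto elim: dvdE)
  with assms(2) \<open>d > 0\<close> have "m \<le> 4 * n" by (simp add: mult.left_commute)
  with m that show ?thesis by (elim odd_index_cases) blast+
qed

text \<open>\<open>P\<close> is a \<open>suminf\<close>, so the equation alone does not assert
  convergence; the \<open>sums\<close> conjunct does.\<close>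

theorem theorem3p4:
  fixes r N :: nat and a :: "nat \<Rightarrow> real"
  assumes "r \<ge> 3" and "odd r" and "N = r ^ 2 - 4"
    and "a N = (- 1) ^ ((r + 1) div 2) * 4 * golden_conj ^ N"
    and "a (3 * N) = (- 1) ^ ((r - 1) div 2) * 4 * golden_conj ^ (3 * N)"
    and "\<And>i j. i \<notin> {N, 3 * N} \<Longrightarrow> j \<in> {1..r + 2} \<Longrightarrow> i = (r - 2) * (4 * j - 3) \<Longrightarrow>
           a i = - real (r - 2) * golden_conj ^ i"
    and "\<And>i j. i \<notin> {N, 3 * N} \<Longrightarrow> j \<in> {1..r + 2} \<Longrightarrow> i = (r - 2) * (4 * j - 1) \<Longrightarrow>
           a i = real (r - 2) * golden_conj ^ i"
    and "\<And>i j. i \<notin> {N, 3 * N} \<Longrightarrow> j \<in> {1..r - 2} \<Longrightarrow> i = (r + 2) * (4 * j - 3) \<Longrightarrow>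
           a i = real (r + 2) * golden_conj ^ i"
    and "\<And>i j. i \<notin> {N, 3 * N} \<Longrightarrow> j \<in> {1..r - 2} \<Longrightarrow> i = (r + 2) * (4 * j - 1) \<Longrightarrow>
           a i = - real (r + 2) * golden_conj ^ i"
    and "\<And>i. i \<in> {1..4 * N} \<Longrightarrow> i \<notin> {N, 3 * N} \<Longrightarrow>
           \<forall>j\<in>{1..r + 2}. i \<noteq> (r - 2) * (4 * j - 3) \<and> i \<noteq> (r - 2) * (4 * j - 1) \<Longrightarrow>
           \<forall>j\<in>{1..r - 2}. i \<noteq> (r + 2) * (4 * j - 3) \<and> i \<noteq> (r + 2) * (4 * j - 1) \<Longrightarrow>
           a i = 0"
  shows "arctan (1 / real (fib r)) = P 1 (golden ^ (4 * N)) (4 * N) a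
    \<and> (\<lambda>k. 1 / golden ^ (4 * N * k) * (\<Sum>i = 1..4 * N. a i / real (4 * N * k + i)))
        sums arctan (1 / real (fib r))"
proof -
  define s where "s = r - 2"
  have r: "r = s + 2" and "r - 2 = s" "r + 2 = s + 4" and "odd s" "s > 0"
    using assms(1,2) by (auto simp: s_def)
  have N: "N = s * (s + 4)"
    by (simp add: assms(3) r power2_eq_square algebra_simps)
  then have "N > 0" using \<open>s > 0\<close> by auto
  have "coprime s 4"
    using \<open>odd s\<close> coprime_power_right_iff[of s 2 2] by simp
  then have cop: "coprime s (s + 4)" by (simp add: coprime_iff_gcd_eq_1)
  define g where "g = gregory_coeff golden_conj"
  have odd_mult: "odd (4 * j - 3)" "odd (4 * j - 1)" if "j \<ge> 1" for j :: nat
    using that by presburger+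

  \<comment> \<open>The prescribed values are recognised on one full period as a difference of two
    Gregory coefficients; from here on \<open>a\<close> enters only through this identity.\<close>
  have coeff: "a i = g (s + 4) i - g s i" if i: "i \<in> {1..4 * N}" for i
  proof -
    obtain t where t: "s = 2 * t + 1" using \<open>odd s\<close> by (elim oddE)
    \<comment> \<open>At multiples of \<open>N = s * (s + 4)\<close> both terms are present, and
      each character is evaluated at the complementary factor.\<close>
    have at: "g (s + 4) (N * m) - g s (N * m)
        = ((s + 4) * chi4 (s * m) - s * chi4 ((s + 4) * m)) * golden_conj ^ (N * m)" for m
    proof -
      have "g (s + 4) (N * m) = (s + 4) * chi4 (s * m) * golden_conj ^ (N * m)"
        using gregory_coeff_mult[of "s + 4" golden_conj "s * m"]
        by (simp add: g_def N ac_simps)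
      moreover have "g s (N * m) = s * chi4 ((s + 4) * m) * golden_conj ^ (N * m)"
        using gregory_coeff_mult[of s golden_conj "(s + 4) * m"] \<open>s > 0\<close>
        by (simp add: g_def N ac_simps)
      ultimately show ?thesis by (simp only: left_diff_distrib)
    qed
    show ?thesis
    proof (cases "i \<in> {N, 3 * N}")
      case True
      \<comment> \<open>Since \<open>s\<close> and \<open>s + 4\<close> agree modulo 4, both
        characters equal \<open>(- 1) ^ t\<close> and the weights leave
        \<open>(s + 4) - s = 4\<close>. The factor 3 flips the sign, just as \<open>t + 1\<close>
        differs in parity from \<open>t + 2\<close>.\<close>
      have "s + 4 = 2 * (t + 2) + 1" "s * 3 = 2 * (3 * t + 1) + 1"
        "(s + 4) * 3 = 2 * (3 * t + 7) + 1" by (simp_all add: t)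
      then have "chi4 s = (- 1) ^ t" "chi4 (s + 4) = (- 1) ^ t"
        "chi4 (s * 3) = - ((- 1) ^ t)" "chi4 ((s + 4) * 3) = - ((- 1) ^ t)"
        by (simp_all only: t chi4_odd) (simp_all add: power_add power_mult)
      moreover have "(r + 1) div 2 = t + 2" "(r - 1) div 2 = t + 1"
        by (simp_all add: r t)
      ultimately show ?thesis
        using True at[of 1] at[of 3] assms(4,5) by (auto simp: algebra_simps)
    next
      case False
      \<comment> \<open>Away from \<open>N\<close> and \<open>3 * N\<close> the two supports are
        disjoint, so in the four listed cases one of the two terms vanishes.\<close>
      have disj: "\<not> (s dvd i \<and> s + 4 dvd i \<and> odd i)"
        using odd_common_multiple_cases[OF cop] False i N by auto
      consider
          (a1) j where "j \<in> {1..r + 2}" "i = s * (4 * j - 3)"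
        | (a3) j where "j \<in> {1..r + 2}" "i = s * (4 * j - 1)"
        | (b1) j where "j \<in> {1..r - 2}" "i = (s + 4) * (4 * j - 3)"
        | (b3) j where "j \<in> {1..r - 2}" "i = (s + 4) * (4 * j - 1)"
        | (none) "\<forall>j\<in>{1..r + 2}. i \<noteq> s * (4 * j - 3) \<and> i \<noteq> s * (4 * j - 1)"
            "\<forall>j\<in>{1..r - 2}. i \<noteq> (s + 4) * (4 * j - 3) \<and> i \<noteq> (s + 4) * (4 * j - 1)"
        by blast
      then show ?thesis
      proof cases
        case a1
        then have "odd i" "s dvd i" using \<open>odd s\<close> odd_mult by auto
        with disj have "g (s + 4) i = 0" by (auto simp: g_def gregory_coeff_def)
        moreover have "a i = - real s * golden_conj ^ i"
          using assms(6)[OF False a1(1)] a1(2) unfolding \<open>r - 2 = s\<close> by blast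
        moreover have "g s i = real s * golden_conj ^ i"
          using a1 gregory_coeff_residues(1)[of s j golden_conj] \<open>s > 0\<close>
          unfolding g_def a1(2) by auto
        ultimately show ?thesis by simp
      next
        case a3
        then have "odd i" "s dvd i" using \<open>odd s\<close> odd_mult by auto
        with disj have "g (s + 4) i = 0" by (auto simp: g_def gregory_coeff_def)
        moreover have "a i = real s * golden_conj ^ i"
          using assms(7)[OF False a3(1)] a3(2) unfolding \<open>r - 2 = s\<close> by blast
        moreover have "g s i = - (real s * golden_conj ^ i)"
          using a3 gregory_coeff_residues(2)[of s j golden_conj] \<open>s > 0\<close>
          unfolding g_def a3(2) by auto
        ultimately show ?thesis by simp
      next
        case b1
        then have "odd i" "s + 4 dvd i" using \<open>odd s\<close> odd_mult by auto
        with disj have "g s i = 0" by (auto simp: g_def gregory_coeff_def)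
        moreover have "a i = real (s + 4) * golden_conj ^ i"
          using assms(8)[OF False b1(1)] b1(2) unfolding \<open>r + 2 = s + 4\<close> by blast
        moreover have "g (s + 4) i = real (s + 4) * golden_conj ^ i"
          using b1 gregory_coeff_residues(1)[of "s + 4" j golden_conj] \<open>s > 0\<close>
          unfolding g_def b1(2) by auto
        ultimately show ?thesis by simp
      next
        case b3
        then have "odd i" "s + 4 dvd i" using \<open>odd s\<close> odd_mult by auto
        with disj have "g s i = 0" by (auto simp: g_def gregory_coeff_def)
        moreover have "a i = - real (s + 4) * golden_conj ^ i"
          using assms(9)[OF False b3(1)] b3(2) unfolding \<open>r + 2 = s + 4\<close> by blast
        moreover have "g (s + 4) i = - (real (s + 4) * golden_conj ^ i)"
          using b3 gregory_coeff_residues(2)[of "s + 4" j golden_conj] \<open>s > 0\<close>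
          unfolding g_def b3(2) by auto
        ultimately show ?thesis by (simp add: algebra_simps)
      next
        case none
        \<comment> \<open>Both bounds are \<open>4 * N\<close>, because \<open>r + 2 = s + 4\<close>
          and \<open>r - 2 = s\<close>.\<close>
        have le: "i \<le> 4 * (s * (r + 2))" "i \<le> 4 * ((s + 4) * (r - 2))"
          using i by (auto simp: N r algebra_simps)
        have "g s i = 0"
          using none(1) le(1) unfolding g_def by (metis gregory_coeff_nonzeroE)
        moreover have "g (s + 4) i = 0"
          using none(2) le(2) unfolding g_def by (metis gregory_coeff_nonzeroE)
        moreover have "a i = 0"
          using assms(10)[OF i False, unfolded \<open>r - 2 = s\<close> \<open>r + 2 = s + 4\<close>] none
          unfolding \<open>r - 2 = s\<close> \<open>r + 2 = s + 4\<close> by blast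
        ultimately show ?thesis by simp
      qed
    qed
  qed

  define f where "f i = (g (s + 4) i - g s i) / real i" for i
  have "f sums (arctan (golden_conj ^ (s + 4)) - arctan (golden_conj ^ s))"
    unfolding f_def diff_divide_distrib g_def
    using \<open>s > 0\<close> abs_golden_conj_less_1
    by (intro sums_diff gregory_coeff_sums) auto
  then have "f sums arctan (1 / real (fib r))"
    unfolding r arctan_inverse_fib[OF \<open>odd s\<close>] .
  \<comment> \<open>The index 0 is dropped so that blocks begin at 1, as in \<open>P\<close>; its
    term is a division by zero, hence 0.\<close>
  moreover have "f 0 = 0" by (simp add: f_def)
  ultimately have "(\<lambda>i. f (Suc i)) sums arctan (1 / real (fib r))"
    by (simp add: sums_Suc_iff)
  then have "(\<lambda>k. \<Sum>i = k * (4 * N)..<k * (4 * N) + 4 * N. f (Suc i))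
      sums arctan (1 / real (fib r))"
    using \<open>N > 0\<close> by (intro sums_group) auto
  moreover have "(\<Sum>i = k * (4 * N)..<k * (4 * N) + 4 * N. f (Suc i))
      = 1 / golden ^ (4 * N * k) * (\<Sum>i = 1..4 * N. a i / real (4 * N * k + i))" for k
  proof -
    \<comment> \<open>The sign in \<open>golden_conj = - 1 / golden\<close> disappears because the
      exponent is even.\<close>
    have inv: "1 / golden ^ (4 * N * k) = golden_conj ^ (4 * N * k)"
      by (simp add: golden_conj_def power_divide)
    \<comment> \<open>Through \<open>Suc\<close>, block \<open>k\<close> covers the indices from
      \<open>4 * N * k + 1\<close> to \<open>4 * N * k + 4 * N\<close>; the witnesses translate it
      to \<open>{1..4 * N}\<close> and back.\<close>
    have "(\<Sum>i = k * (4 * N)..<k * (4 * N) + 4 * N. f (Suc i))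
        = (\<Sum>i = 1..4 * N. f (4 * N * k + i))"
      by (rule sum.reindex_bij_witness[of _ "\<lambda>i. 4 * N * k + i - 1" "\<lambda>i. Suc i - 4 * N * k"])
        (auto simp: ac_simps)
    also have "\<dots> = (\<Sum>i = 1..4 * N. golden_conj ^ (4 * N * k) * (a i / real (4 * N * k + i)))"
    proof (rule sum.cong[OF refl])
      fix i assume i: "i \<in> {1..4 * N}"
      have "g d (4 * N * k + i) = golden_conj ^ (4 * N * k) * g d i" if "d dvd N" for d
        unfolding g_def using that by (rule gregory_coeff_shift)
      then have "g (s + 4) (4 * N * k + i) - g s (4 * N * k + i)
          = golden_conj ^ (4 * N * k) * a i"
        using coeff[OF i] by (simp add: N right_diff_distrib)
      then show "f (4 * N * k + i) = golden_conj ^ (4 * N * k) * (a i / real (4 * N * k + i))"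
        unfolding f_def by simp
    qed
    finally show ?thesis by (simp only: inv sum_distrib_left)
  qed
  ultimately have sums: "(\<lambda>k. 1 / golden ^ (4 * N * k)
      * (\<Sum>i = 1..4 * N. a i / real (4 * N * k + i))) sums arctan (1 / real (fib r))"
    by simp
  then have "arctan (1 / real (fib r)) = P 1 (golden ^ (4 * N)) (4 * N) a"
    unfolding P_def by (simp add: sums_iff mult.commute flip: power_mult)
  with sums show ?thesis by blast
qed

end
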